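(* Consider the problem of projection estimation with homogeneous Gaussian errors, $\varepsilon_i\sim\mathcal N(0,\sigma^2)$ independent, and probabilistic loss, i.e. with critical values $\mathfrak z_{m,m^\circ}=z_{m,m^\circ}(x+q_{m^\circ})+\beta\sqrt{\mathsf p_{m,m^\circ}}$ for given $x>0$, $\beta\ge0$. Then for all $m>m^\circ$ in $\mathcal M$ it holds $\mathsf p_{m,m^\circ}=\sigma^2(m-m^\circ)$, $\lambda_{m,m^\circ}=\sigma^2$, and $$\mathfrak z_{m,m^\circ}\le\sigma(1+\beta)\sqrt{m-m^\circ}+\sigma\sqrt{2x+2\log(|\mathcal M|)},$$ $$\bar{\mathfrak z}_{m^*}\le\sigma(1+\beta)\sqrt{m^*}+\sigma\sqrt{2x+2\log(|\mathcal M|)}.$$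
   Context: Projection estimation: $Y=f^*+\varepsilon\in\mathbb R^n$ with $f^*=\Psi^\top\theta^*$, for a $p\times n$ design matrix $\Psi$ whose rows are ordered features. $\mathcal M$ is a finite set of positive integers; for $m\in\mathcal M$, $\Psi_m$ is the $m\times n$ submatrix of $\Psi$ formed by the first $m$ features, and the estimator of the response is $\mathcal K_mY=\Pi_mY$ where $\Pi_m=\Psi_m^\top(\Psi_m\Psi_m^\top)^{-1}\Psi_m$ is the orthogonal projector (of rank $m$) onto the corresponding feature subspace. For $m>m^\circ$ put $\xi_{m,m^\circ}=(\Pi_m-\Pi_{m^\circ})\varepsilon$, $b_{m,m^\circ}=(\Pi_m-\Pi_{m^\circ})f^*$, $\mathbb V_{m,m^\circ}=\mathrm{Var}(\xi_{m,m^\circ})$, $\mathsf p_{m,m^\circ}=\mathrm{tr}(\mathbb V_{m,m^\circ})$, $\lambda_{m,m^\circ}=\|\mathbb V_{m,m^\circ}\|_{\mathrm{op}}$ (operator norm). $\mathcal M^+(m^\circ)=\{m\in\mathcal M:m>m^\circ\}$, $\mathcal M^-(m^\circ)=\{m\in\mathcal M:m<m^\circ\}$. Oracle: $m^*$ is the smallest $m^\circ\in\mathcal M$ such that $\|b_{m,m^\circ}\|^2\le\beta^2\mathsf p_{m,m^\circ}$ for all $m\in\mathcal M^+(m^\circ)$. Tail function: $\mathbb P(\|\xi_{m,m^\circ}\|>z_{m,m^\circ}(t))=e^{-t}$. Multiplicity correction: $q_{m^\circ}=q_{m^\circ}(x)$ is defined by $\mathbb P\bigl(\bigcup_{m\in\mathcal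 M^+(m^\circ)}\{\|\xi_{m,m^\circ}\|\ge z_{m,m^\circ}(x+q_{m^\circ})\}\bigr)=e^{-x}$. Payment for adaptation: let $\mathcal M^c\subseteq\mathcal M^-(m^* )$ be a subset such that $\|b_{m^*,m}\|>\mathfrak z_{m^*,m}+z_{m^*,m}(x_s)$ for all $m\in\mathcal M^c$, with $x_s=x+\log(|\mathcal M^c|)$ (void if $\mathcal M^c=\emptyset$), and $\bar{\mathfrak z}_{m^*}=\max_{m\in\mathcal M^-(m^* )\setminus\mathcal M^c}\mathfrak z_{m^*,m}$ (zero if the set is empty). *)

theory Defs
  imports
    "HOL-Probability.Probability"
    "Jordan_Normal_Form.DL_Submatrix"
    "Jordan_Normal_Form.Gauss_Jordan_Elimination"
begin

definition vnorm :: "real Matrix.vec \<Rightarrow> real" where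
  "vnorm v = sqrt (scalar_prod v v)"

definition mtrace :: "real Matrix.mat \<Rightarrow> real" where
  "mtrace A = (\<Sum>i<dim_row A. A $$ (i, i))"

definition op_norm :: "real Matrix.mat \<Rightarrow> real" where
  "op_norm A = Sup {vnorm (A *\<^sub>v v) | v. v \<in> carrier_vec (dim_col A) \<and> vnorm v \<le> 1}"

text \<open>Covariance matrix \<open>Var(X)\<close> of an \<open>n\<close>-dimensional random vector \<open>X\<close>.\<close>

definition cov_mat :: "'a measure \<Rightarrow> nat \<Rightarrow> ('a \<Rightarrow> real Matrix.vec) \<Rightarrow> real Matrix.mat" where
  "cov_mat P n X = Matrix.mat n n (\<lambda>(i, j).
     (\<integral>\<omega>. (vec_index (X \<omega>) i - (\<integral>\<omega>'. vec_index (X \<omega>') i \<partial>P))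
          * (vec_index (X \<omega>) j - (\<integral>\<omega>'. vec_index (X \<omega>') j \<partial>P)) \<partial>P))"

text \<open>The rows of the design matrix \<open>\<Psi>\<close> are the ordered features; \<open>feat \<Psi> m\<close> keeps the
  first \<open>m\<close> of them (it has \<open>m\<close> rows only if \<open>m \<le> dim_row \<Psi>\<close>).\<close>

definition feat :: "real Matrix.mat \<Rightarrow> nat \<Rightarrow> real Matrix.mat" where
  "feat \<Psi> m = submatrix \<Psi> {..<m} UNIV"

definition gram :: "real Matrix.mat \<Rightarrow> nat \<Rightarrow> real Matrix.mat" where
  "gram \<Psi> m = feat \<Psi> m * transpose_mat (feat \<Psi> m)"

text \<open>\<open>the (mat_inverse A)\<close> is the inverse of \<open>A\<close> when \<open>A\<close> is invertible, and unspecified otherwise.\<close>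

definition proj :: "real Matrix.mat \<Rightarrow> nat \<Rightarrow> real Matrix.mat" where
  "proj \<Psi> m = transpose_mat (feat \<Psi> m) * the (mat_inverse (gram \<Psi> m)) * feat \<Psi> m"

text \<open>The errors are given by their coordinates \<open>\<epsilon> i\<close>, \<open>i < n\<close>, where \<open>n = dim_col \<Psi>\<close>.\<close>

definition xi :: "real Matrix.mat \<Rightarrow> (nat \<Rightarrow> 'a \<Rightarrow> real) \<Rightarrow> nat \<Rightarrow> nat \<Rightarrow> 'a \<Rightarrow> real Matrix.vec" where
  "xi \<Psi> \<epsilon> m m0 \<omega> = (proj \<Psi> m - proj \<Psi> m0) *\<^sub>v Matrix.vec (dim_col \<Psi>) (\<lambda>i. \<epsilon> i \<omega>)"

definition bias :: "real Matrix.mat \<Rightarrow> real Matrix.vec \<Rightarrow> nat \<Rightarrow> nat \<Rightarrow> real Matrix.vec" where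
  "bias \<Psi> f m m0 = (proj \<Psi> m - proj \<Psi> m0) *\<^sub>v f"

definition Vmat :: "'a measure \<Rightarrow> real Matrix.mat \<Rightarrow> (nat \<Rightarrow> 'a \<Rightarrow> real) \<Rightarrow> nat \<Rightarrow> nat \<Rightarrow> real Matrix.mat" where
  "Vmat P \<Psi> \<epsilon> m m0 = cov_mat P (dim_col \<Psi>) (xi \<Psi> \<epsilon> m m0)"

definition pdim :: "'a measure \<Rightarrow> real Matrix.mat \<Rightarrow> (nat \<Rightarrow> 'a \<Rightarrow> real) \<Rightarrow> nat \<Rightarrow> nat \<Rightarrow> real" where
  "pdim P \<Psi> \<epsilon> m m0 = mtrace (Vmat P \<Psi> \<epsilon> m m0)"

definition lam :: "'a measure \<Rightarrow> real Matrix.mat \<Rightarrow> (nat \<Rightarrow> 'a \<Rightarrow> real) \<Rightarrow> nat \<Rightarrow> nat \<Rightarrow> real" where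
  "lam P \<Psi> \<epsilon> m m0 = op_norm (Vmat P \<Psi> \<epsilon> m m0)"

definition above :: "nat set \<Rightarrow> nat \<Rightarrow> nat set" where
  "above M m0 = {m \<in> M. m0 < m}"

definition below :: "nat set \<Rightarrow> nat \<Rightarrow> nat set" where
  "below M m0 = {m \<in> M. m < m0}"

definition oracle_model :: "'a measure \<Rightarrow> real Matrix.mat \<Rightarrow> (nat \<Rightarrow> 'a \<Rightarrow> real) \<Rightarrow> real Matrix.vec
    \<Rightarrow> real \<Rightarrow> nat set \<Rightarrow> nat" where
  "oracle_model P \<Psi> \<epsilon> f \<beta> M =
     (LEAST m0. m0 \<in> M \<and>
        (\<forall>m\<in>above M m0. (vnorm (bias \<Psi> f m m0))\<^sup>2 \<le> \<beta>\<^sup>2 * pdim P \<Psi> \<epsilon> m m0))"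

text \<open>\<open>z m m0 t\<close> is the tail function. Its defining equation has a solution exactly for \<open>t \<ge> 0\<close>
  (\<open>exp (- t)\<close> is a probability), so the values of \<open>z\<close> at negative arguments carry no meaning.\<close>

definition is_tail_function :: "'a measure \<Rightarrow> real Matrix.mat \<Rightarrow> (nat \<Rightarrow> 'a \<Rightarrow> real) \<Rightarrow> nat set
    \<Rightarrow> (nat \<Rightarrow> nat \<Rightarrow> real \<Rightarrow> real) \<Rightarrow> bool" where
  "is_tail_function P \<Psi> \<epsilon> M z \<longleftrightarrow>
     (\<forall>m0\<in>M. \<forall>m\<in>above M m0. \<forall>t\<ge>0.
        measure P {\<omega> \<in> space P. vnorm (xi \<Psi> \<epsilon> m m0 \<omega>) > z m m0 t} = exp (- t))"

text \<open>\<open>q m0\<close> is only defined when some \<open>m \<in> M\<close> exceeds \<open>m0\<close>: otherwise the union is empty and has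
  probability \<open>0 \<noteq> exp (- x)\<close>. The condition \<open>x + q m0 \<ge> 0\<close> says that the tail function is evaluated
  inside its domain.\<close>

definition is_mult_correction :: "'a measure \<Rightarrow> real Matrix.mat \<Rightarrow> (nat \<Rightarrow> 'a \<Rightarrow> real) \<Rightarrow> nat set
    \<Rightarrow> (nat \<Rightarrow> nat \<Rightarrow> real \<Rightarrow> real) \<Rightarrow> real \<Rightarrow> (nat \<Rightarrow> real) \<Rightarrow> bool" where
  "is_mult_correction P \<Psi> \<epsilon> M z x q \<longleftrightarrow>
     (\<forall>m0\<in>M. above M m0 \<noteq> {} \<longrightarrow>
        x + q m0 \<ge> 0 \<and>
        measure P (\<Union>m\<in>above M m0.
          {\<omega> \<in> space P. vnorm (xi \<Psi> \<epsilon> m m0 \<omega>) \<ge> z m m0 (x + q m0)}) = exp (- x))"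

definition crit :: "'a measure \<Rightarrow> real Matrix.mat \<Rightarrow> (nat \<Rightarrow> 'a \<Rightarrow> real) \<Rightarrow> (nat \<Rightarrow> nat \<Rightarrow> real \<Rightarrow> real)
    \<Rightarrow> (nat \<Rightarrow> real) \<Rightarrow> real \<Rightarrow> real \<Rightarrow> nat \<Rightarrow> nat \<Rightarrow> real" where
  "crit P \<Psi> \<epsilon> z q x \<beta> m m0 = z m m0 (x + q m0) + \<beta> * sqrt (pdim P \<Psi> \<epsilon> m m0)"

text \<open>Payment for adaptation: \<open>zc\<close> stands for the critical values, \<open>ms\<close> for \<open>m*\<close>.\<close>

definition is_Mc :: "real Matrix.mat \<Rightarrow> real Matrix.vec \<Rightarrow> (nat \<Rightarrow> nat \<Rightarrow> real \<Rightarrow> real)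
    \<Rightarrow> (nat \<Rightarrow> nat \<Rightarrow> real) \<Rightarrow> real \<Rightarrow> nat set \<Rightarrow> nat \<Rightarrow> nat set \<Rightarrow> bool" where
  "is_Mc \<Psi> f z zc x M ms Mc \<longleftrightarrow>
     Mc \<subseteq> below M ms \<and>
     (\<forall>m\<in>Mc. vnorm (bias \<Psi> f ms m) > zc ms m + z ms m (x + ln (real (card Mc))))"

definition zbar :: "(nat \<Rightarrow> nat \<Rightarrow> real) \<Rightarrow> nat set \<Rightarrow> nat \<Rightarrow> nat set \<Rightarrow> real" where
  "zbar zc M ms Mc =
     (if below M ms - Mc = {} then 0 else Max (zc ms ` (below M ms - Mc)))"

end

theory Submission
  imports Defs
begin

text \<open>For nested feature spaces \<open>D = \<Pi>\<^sub>m - \<Pi>\<^sub>m\<^sub>0\<close> is again an orthogonal projector, of trace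
  \<open>d = m - m0\<close>. The noise \<open>\<xi> = D \<epsilon>\<close> therefore has covariance \<open>\<sigma>\<^sup>2 D\<close>, whose trace is \<open>\<sigma>\<^sup>2 d\<close> and whose
  operator norm is \<open>\<sigma>\<^sup>2\<close> (\<open>projection_noise\<close>).

  The bound on the critical values rests on a chi-square tail estimate and on a union bound.
  An orthonormal basis of the range of \<open>D\<close> (\<open>orthogonal_projector_orthonormal_basis\<close>) turns
  \<open>|\<xi>|\<^sup>2 / \<sigma>\<^sup>2\<close> into a chi-square variable with \<open>d\<close> degrees of freedom. Its exponential moment at
  \<open>\<mu> < 1/2\<close> is \<open>(1 - 2 \<mu>)\<close> to the power \<open>- d/2\<close> (\<open>gaussian_square_sum_mgf\<close>), and the Chernoff bound with the
  optimal \<open>\<mu>\<close> gives the strict inequality \<open>P(|\<xi>| > \<sigma> (sqrt d + sqrt (2 t))) < exp (- t)\<close> for \<open>t > 0\<close>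
  (\<open>gaussian_square_sum_tail\<close>). The strictness forces \<open>z\<^sub>m\<^sub>,\<^sub>m\<^sub>0(t) \<le> \<sigma> (sqrt d + sqrt (2 t))\<close>:
  a larger \<open>z\<^sub>m\<^sub>,\<^sub>m\<^sub>0(t)\<close> would be exceeded with probability below \<open>exp (- t)\<close>.

  The union bound gives \<open>x + q \<le> x + log |M|\<close>. It concerns the events \<open>|\<xi>| \<ge> z\<close>, whereas the tail
  function controls \<open>|\<xi>| > z\<close>; instead of showing that \<open>|\<xi>|\<close> has no atoms, one compares with the
  tail function at a slightly smaller argument (\<open>multiplicity_correction_bounds\<close>). Inserting this
  value of \<open>t = x + q\<close> bounds every critical value, and \<open>m* - m \<le> m*\<close> then bounds their maximum.\<close>

section \<open>Differences of nested projectors\<close>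

definition orthogonal_projector :: "nat \<Rightarrow> real Matrix.mat \<Rightarrow> bool" where
  "orthogonal_projector n D \<longleftrightarrow> D \<in> carrier_mat n n \<and> transpose_mat D = D \<and> D * D = D"

lemma mtrace_mult_commute:
  assumes "A \<in> carrier_mat n m" "B \<in> carrier_mat m n"
  shows "mtrace (A * B) = mtrace (B * A)"
proof -
  have "mtrace (A * B) = (\<Sum>i<n. \<Sum>k<m. A $$ (i, k) * B $$ (k, i))"
    using assms by (auto simp: mtrace_def scalar_prod_def atLeast0LessThan intro!: sum.cong)
  also have "\<dots> = (\<Sum>k<m. \<Sum>i<n. B $$ (k, i) * A $$ (i, k))"
    by (subst sum.swap) (simp add: mult.commute)
  also have "\<dots> = mtrace (B * A)"
    using assms by (auto simp: mtrace_def scalar_prod_def atLeast0LessThan intro!: sum.cong)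
  finally show ?thesis .
qed

lemma mtrace_minus:
  assumes "A \<in> carrier_mat n n" "B \<in> carrier_mat n n"
  shows "mtrace (A - B) = mtrace A - mtrace B"
  using assms by (auto simp: mtrace_def sum_subtractf)

lemma mat_inverse_invertible:
  fixes A :: "real Matrix.mat"
  assumes A: "A \<in> carrier_mat n n" and inv: "invertible_mat A"
  shows "the (mat_inverse A) \<in> carrier_mat n n"
    "A * the (mat_inverse A) = 1\<^sub>m n" "the (mat_inverse A) * A = 1\<^sub>m n"
proof -
  obtain B where "A * B = 1\<^sub>m (dim_row A)" "B * A = 1\<^sub>m (dim_row B)"
    using inv by (auto simp: invertible_mat_def inverts_mat_def)
  moreover from this have "B \<in> carrier_mat n n"
    using A by (metis carrier_matD(1,2) carrier_matI index_mult_mat(3) index_one_mat(3))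
  ultimately have "A \<in> Units (ring_mat TYPE(real) n undefined)"
    using A by (auto simp: Units_def ring_mat_def)
  then obtain C where "mat_inverse A = Some C"
    using mat_inverse(1)[OF A, of undefined] by (cases "mat_inverse A") auto
  then show "the (mat_inverse A) \<in> carrier_mat n n"
    "A * the (mat_inverse A) = 1\<^sub>m n" "the (mat_inverse A) * A = 1\<^sub>m n"
    using mat_inverse(2)[OF A] by auto
qed

lemma feat_carrier:
  assumes "\<Psi> \<in> carrier_mat p n" "m \<le> p"
  shows "feat \<Psi> m \<in> carrier_mat m n"
proof (rule carrier_matI)
  have "{i. i < dim_row \<Psi> \<and> i \<in> {..<m}} = {..<m}" using assms by auto
  then show "dim_row (feat \<Psi> m) = m" unfolding feat_def dim_submatrix by (metis card_lessThan)
  have "{i. i < dim_col \<Psi> \<and> i \<in> UNIV} = {..<n}" using assms by auto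
  then show "dim_col (feat \<Psi> m) = n" unfolding feat_def dim_submatrix by (metis card_lessThan)
qed

lemma feat_index:
  assumes "\<Psi> \<in> carrier_mat p n" "m \<le> p" "i < m" "j < n"
  shows "feat \<Psi> m $$ (i, j) = \<Psi> $$ (i, j)"
proof -
  have "{a \<in> {..<m}. a < i} = {..<i}" "{a \<in> UNIV. a < j} = {..<j}" using assms(3) by auto
  moreover have "i < dim_row \<Psi>" "j < dim_col \<Psi>" using assms by auto
  ultimately show ?thesis
    using submatrix_index_card[of i \<Psi> j "{..<m}" UNIV] assms(3)
    unfolding feat_def by (metis UNIV_I card_lessThan lessThan_iff)
qed

context
  fixes \<Psi> :: "real Matrix.mat" and p n m :: nat
  assumes \<Psi>: "\<Psi> \<in> carrier_mat p n" and m: "m \<le> p" and inv: "invertible_mat (gram \<Psi> m)"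
begin

private lemma F: "feat \<Psi> m \<in> carrier_mat m n"
  using \<Psi> m by (rule feat_carrier)

private lemma gram_carrier: "gram \<Psi> m \<in> carrier_mat m m"
  using F by (auto simp: gram_def)

private lemmas G_inv = mat_inverse_invertible[OF gram_carrier inv]

text \<open>A left inverse of a matrix equals its right inverse, and transposing \<open>G B = 1\<close> for a symmetric
  \<open>G\<close> exhibits the transpose of \<open>B\<close> as a left inverse.\<close>

lemma gram_inverse_symmetric: "transpose_mat (the (mat_inverse (gram \<Psi> m))) = the (mat_inverse (gram \<Psi> m))"
  (is "transpose_mat ?B = ?B")
proof -
  have sym: "transpose_mat (gram \<Psi> m) = gram \<Psi> m"
    using F by (simp add: gram_def transpose_mult[of _ m n _ m])
  have left: "transpose_mat ?B * gram \<Psi> m = 1\<^sub>m m"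
    using G_inv gram_carrier transpose_mult[of "gram \<Psi> m" m m ?B m] by (simp add: sym)
  have "transpose_mat ?B = transpose_mat ?B * (gram \<Psi> m * ?B)"
    using G_inv by (simp add: right_mult_one_mat[of _ m m])
  also have "\<dots> = transpose_mat ?B * gram \<Psi> m * ?B"
    using G_inv gram_carrier by (simp add: assoc_mult_mat[of _ m m _ m _ m])
  also have "\<dots> = ?B"
    using G_inv by (simp add: left)
  finally show ?thesis .
qed

lemma proj_carrier: "proj \<Psi> m \<in> carrier_mat n n"
  using F G_inv by (auto simp: proj_def)

lemma proj_symmetric: "transpose_mat (proj \<Psi> m) = proj \<Psi> m"
proof -
  let ?B = "the (mat_inverse (gram \<Psi> m))" and ?F = "feat \<Psi> m"
  have "transpose_mat (proj \<Psi> m) = transpose_mat ?F * transpose_mat (transpose_mat ?F * ?B)"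
    unfolding proj_def using F G_inv by (intro transpose_mult[of _ n m _ n]) auto
  also have "transpose_mat (transpose_mat ?F * ?B) = ?B * ?F"
    using F G_inv by (subst transpose_mult[of _ n m _ m]) (auto simp: gram_inverse_symmetric)
  finally show ?thesis
    unfolding proj_def using F G_inv by (simp add: assoc_mult_mat[of _ n m _ m _ n])
qed

lemma proj_fixes_features: "proj \<Psi> m * transpose_mat (feat \<Psi> m) = transpose_mat (feat \<Psi> m)"
proof -
  let ?B = "the (mat_inverse (gram \<Psi> m))" and ?F = "feat \<Psi> m"
  have "proj \<Psi> m * transpose_mat ?F = transpose_mat ?F * ?B * (?F * transpose_mat ?F)"
    unfolding proj_def using F G_inv by (intro assoc_mult_mat[of _ n m _ n _ m]) auto
  also have "\<dots> = transpose_mat ?F * (?B * gram \<Psi> m)"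
    unfolding gram_def[symmetric] using F G_inv gram_carrier
    by (intro assoc_mult_mat[of _ n m _ m _ m]) auto
  finally show ?thesis using F G_inv by (simp add: right_mult_one_mat[of _ n m])
qed

text \<open>Cyclicity of the trace moves the features together, so that the Gram matrix meets its own
  inverse and the trace of the identity of size \<open>m\<close> remains.\<close>

lemma mtrace_proj: "mtrace (proj \<Psi> m) = real m"
proof -
  let ?B = "the (mat_inverse (gram \<Psi> m))" and ?F = "feat \<Psi> m"
  have "mtrace (proj \<Psi> m) = mtrace (?F * (transpose_mat ?F * ?B))"
    unfolding proj_def using F G_inv by (intro mtrace_mult_commute[of _ n m]) auto
  also have "?F * (transpose_mat ?F * ?B) = ?F * transpose_mat ?F * ?B"
    using F G_inv by (intro assoc_mult_mat[of _ m n _ m _ m, symmetric]) auto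
  also have "\<dots> = 1\<^sub>m m" unfolding gram_def[symmetric] by (rule G_inv(2))
  also have "mtrace (1\<^sub>m m) = real m" by (auto simp: mtrace_def)
  finally show ?thesis .
qed

text \<open>The range of the smaller projector is spanned by the first \<open>m0\<close> features, and these are among
  the features that the larger projector fixes.\<close>

lemma proj_absorbs_smaller:
  assumes "m0 \<le> m" "invertible_mat (gram \<Psi> m0)"
  shows "proj \<Psi> m * proj \<Psi> m0 = proj \<Psi> m0"
proof -
  let ?F0 = "feat \<Psi> m0" and ?B0 = "the (mat_inverse (gram \<Psi> m0))"
  have F0: "?F0 \<in> carrier_mat m0 n" using \<Psi> by (rule feat_carrier) (use m assms(1) in simp)
  then have G0: "gram \<Psi> m0 \<in> carrier_mat m0 m0" by (auto simp: gram_def)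
  note B0 = mat_inverse_invertible(1)[OF G0 assms(2)]
  have cols: "proj \<Psi> m * transpose_mat ?F0 = transpose_mat ?F0"
  proof (rule eq_matI)
    fix i j assume "i < dim_row (transpose_mat ?F0)" "j < dim_col (transpose_mat ?F0)"
    then have ij: "i < n" "j < m0" using F0 by auto
    have row_eq: "row ?F0 j = row (feat \<Psi> m) j"
      using F F0 ij assms(1) m \<Psi> by (intro eq_vecI) (auto simp: feat_index)
    have "(proj \<Psi> m * transpose_mat ?F0) $$ (i, j) = (proj \<Psi> m * transpose_mat (feat \<Psi> m)) $$ (i, j)"
      using F F0 ij assms(1) proj_carrier by (simp add: row_eq)
    also have "\<dots> = transpose_mat ?F0 $$ (i, j)"
      using F F0 ij assms(1) m \<Psi> by (simp add: proj_fixes_features feat_index)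
    finally show "(proj \<Psi> m * transpose_mat ?F0) $$ (i, j) = transpose_mat ?F0 $$ (i, j)" .
  qed (use F0 proj_carrier in auto)
  have "proj \<Psi> m * proj \<Psi> m0 = proj \<Psi> m * (transpose_mat ?F0 * (?B0 * ?F0))"
    unfolding proj_def[of \<Psi> m0] using F0 B0 by (simp add: assoc_mult_mat[of _ n m0 _ m0 _ n])
  also have "\<dots> = proj \<Psi> m * transpose_mat ?F0 * (?B0 * ?F0)"
    using F0 B0 proj_carrier by (intro assoc_mult_mat[of _ n n _ m0 _ n, symmetric]) auto
  also have "\<dots> = proj \<Psi> m0"
    unfolding cols proj_def[of \<Psi> m0] using F0 B0 by (simp add: assoc_mult_mat[of _ n m0 _ m0 _ n])
  finally show ?thesis .
qed

end

text \<open>For \<open>A = \<Pi>\<^sub>m\<close> and \<open>B = \<Pi>\<^sub>m\<^sub>0\<close>, absorption gives \<open>A B = B\<close>, and transposition of it \<open>B A = B\<close>; expanding \<open>(A - B)\<^sup>2\<close> then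
  leaves \<open>A - B - B + B\<close>.\<close>

lemma orthogonal_projector_proj_diff:
  assumes \<Psi>: "\<Psi> \<in> carrier_mat p n" and le: "m0 \<le> m" "m \<le> p"
    and inv: "invertible_mat (gram \<Psi> m)" "invertible_mat (gram \<Psi> m0)"
  shows "orthogonal_projector n (proj \<Psi> m - proj \<Psi> m0)"
    and "mtrace (proj \<Psi> m - proj \<Psi> m0) = real (m - m0)"
proof -
  let ?A = "proj \<Psi> m" and ?B = "proj \<Psi> m0"
  have le': "m0 \<le> p" using le by simp
  note A = proj_carrier[OF \<Psi> le(2) inv(1)] proj_symmetric[OF \<Psi> le(2) inv(1)]
  note B = proj_carrier[OF \<Psi> le' inv(2)] proj_symmetric[OF \<Psi> le' inv(2)]
  have AA: "?A * ?A = ?A"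
    by (rule proj_absorbs_smaller[OF \<Psi> le(2) inv(1) order.refl inv(1)])
  have AB: "?A * ?B = ?B"
    by (rule proj_absorbs_smaller[OF \<Psi> le(2) inv(1) le(1) inv(2)])
  have BB: "?B * ?B = ?B"
    by (rule proj_absorbs_smaller[OF \<Psi> le' inv(2) order.refl inv(2)])
  have BA: "?B * ?A = ?B"
    using transpose_mult[OF A(1) B(1)] unfolding AB A(2) B(2) by (rule sym)
  have "(?A - ?B) * (?A - ?B) = ?A * (?A - ?B) - ?B * (?A - ?B)"
    using A B by (intro minus_mult_distrib_mat[of _ n n _ _ n]) auto
  also have "\<dots> = (?A - ?B) - (?B - ?B)"
    using A(1) B(1) by (simp add: mult_minus_distrib_mat[of _ n n _ n] AA AB BA BB)
  also have "\<dots> = ?A - ?B" using A(1) B(1) by auto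
  finally show "orthogonal_projector n (?A - ?B)"
    using A B by (auto simp: orthogonal_projector_def transpose_minus)
  show "mtrace (?A - ?B) = real (m - m0)"
    using le(1) by (simp add: mtrace_minus[OF A(1) B(1)] mtrace_proj[OF \<Psi> le(2) inv(1)]
        mtrace_proj[OF \<Psi> le' inv(2)] of_nat_diff)
qed

section \<open>Orthonormal bases of projector ranges\<close>

text \<open>Induction on the trace replaces the spectral theorem. A projector of positive trace has a
  nonzero diagonal entry \<open>D c c\<close>, which is also the squared norm of its column \<open>c\<close>. The normalised
  column \<open>v\<close> is a unit vector in the range of \<open>D\<close>, and subtracting the projector \<open>v v\<^sup>T\<close> leaves a
  projector of trace smaller by one. At trace zero all entries vanish, since their squares sum to
  the trace.\<close>

lemma projector_orthonormal_decomposition: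
  fixes D :: "nat \<Rightarrow> nat \<Rightarrow> real"
  assumes "\<And>i j. i < n \<Longrightarrow> j < n \<Longrightarrow> D i j = D j i"
    and "\<And>i k. i < n \<Longrightarrow> k < n \<Longrightarrow> (\<Sum>j<n. D i j * D j k) = D i k"
    and "(\<Sum>i<n. D i i) = real d"
  shows "\<exists>u. (\<forall>k<d. \<forall>l<d. (\<Sum>i<n. u k i * u l i) = (if k = l then 1 else 0)) \<and>
             (\<forall>i<n. \<forall>j<n. D i j = (\<Sum>k<d. u k i * u k j))"
  using assms
proof (induction d arbitrary: D)
  case 0
  have diag: "D i i = (\<Sum>j<n. (D i j)\<^sup>2)" if "i < n" for i
    unfolding 0(2)[OF that that, symmetric] power2_eq_square
    by (intro sum.cong refl) (use that in \<open>simp add: 0(1)\<close>)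
  have "(\<Sum>i<n. \<Sum>j<n. (D i j)\<^sup>2) = 0"
    using 0(3) diag by simp
  then have "\<forall>i<n. \<forall>j<n. D i j = 0"
    by (auto simp: sum_nonneg_eq_0_iff sum_nonneg)
  then show ?case by simp
next
  case (Suc d)
  note sym = Suc.prems(1) and idem = Suc.prems(2)
  have "(\<Sum>i<n. D i i) \<noteq> 0" unfolding Suc.prems(3) by (rule of_nat_neq_0)
  then have "\<exists>c<n. D c c \<noteq> 0" using sum.neutral[of "{..<n}" "\<lambda>i. D i i"] by blast
  then obtain c where c: "c < n" "D c c \<noteq> 0" by blast
  have diag: "D c c = (\<Sum>j<n. (D j c)\<^sup>2)"
    unfolding idem[OF c(1) c(1), symmetric] power2_eq_square
    by (intro sum.cong refl) (use c in \<open>simp add: sym\<close>)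
  then have pos: "D c c > 0" using c(2) sum_nonneg[of "{..<n}" "\<lambda>j. (D j c)\<^sup>2"] by simp
  define v where "v i = D i c / sqrt (D c c)" for i
  have Dv: "(\<Sum>j<n. D i j * v j) = v i" if "i < n" for i
    using idem[OF that c(1)] by (simp add: v_def sum_divide_distrib[symmetric])
  have vv: "(\<Sum>i<n. v i * v i) = 1"
    using pos diag by (simp add: v_def sum_divide_distrib[symmetric] power2_eq_square)
  define E where "E i j = D i j - v i * v j" for i j
  have Ev: "(\<Sum>j<n. E i j * v j) = 0" if "i < n" for i
  proof -
    have "(\<Sum>j<n. E i j * v j) = (\<Sum>j<n. D i j * v j) - v i * (\<Sum>j<n. v j * v j)"
      by (simp add: E_def algebra_simps sum_subtractf sum_distrib_left)
    then show ?thesis using Dv[OF that] vv by simp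
  qed
  have "\<exists>u. (\<forall>k<d. \<forall>l<d. (\<Sum>i<n. u k i * u l i) = (if k = l then 1 else 0)) \<and>
             (\<forall>i<n. \<forall>j<n. E i j = (\<Sum>k<d. u k i * u k j))"
  proof (rule Suc.IH)
    show "E i j = E j i" if "i < n" "j < n" for i j
      using that by (simp add: E_def sym mult.commute)
    show "(\<Sum>j<n. E i j * E j k) = E i k" if "i < n" "k < n" for i k
    proof -
      have "(\<Sum>j<n. E i j * E j k) = (\<Sum>j<n. E i j * D j k) - (\<Sum>j<n. E i j * v j) * v k"
        by (simp add: E_def[of _ k] algebra_simps sum_subtractf sum_distrib_left sum_distrib_right)
      also have "\<dots> = (\<Sum>j<n. D i j * D j k) - v i * (\<Sum>j<n. D k j * v j)"
        using that unfolding Ev[OF that(1)]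
        by (simp add: E_def algebra_simps sum_subtractf sum_distrib_left sym[of k])
      finally show ?thesis using that by (simp add: idem Dv E_def)
    qed
    show "(\<Sum>i<n. E i i) = real d"
      using Suc.prems(3) vv by (simp add: E_def sum_subtractf)
  qed
  then obtain u where u: "\<And>k l. k < d \<Longrightarrow> l < d \<Longrightarrow> (\<Sum>i<n. u k i * u l i) = (if k = l then 1 else 0)"
    and E_u: "\<And>i j. i < n \<Longrightarrow> j < n \<Longrightarrow> E i j = (\<Sum>k<d. u k i * u k j)" by blast
  \<comment> \<open>\<open>E v = 0\<close> gives \<open>\<Sum>k. \<langle>u k, v\<rangle>\<^sup>2 = \<langle>v, E v\<rangle> = 0\<close>, so each \<open>u k\<close> is orthogonal to \<open>v\<close>.\<close>
  have "(\<Sum>k<d. (\<Sum>i<n. u k i * v i)\<^sup>2) = (\<Sum>k<d. \<Sum>i<n. \<Sum>j<n. v i * (u k i * u k j * v j))"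
    by (simp add: power2_eq_square sum_product algebra_simps)
  also have "\<dots> = (\<Sum>i<n. \<Sum>j<n. \<Sum>k<d. v i * (u k i * u k j * v j))"
    by (subst sum.swap, rule sum.cong, rule refl, rule sum.swap)
  also have "\<dots> = (\<Sum>i<n. v i * (\<Sum>j<n. E i j * v j))"
    by (simp add: E_u sum_distrib_left sum_distrib_right)
  also have "\<dots> = 0" by (simp add: Ev)
  finally have orth: "(\<Sum>i<n. u k i * v i) = 0" if "k < d" for k
    using that by (auto simp: sum_nonneg_eq_0_iff)
  let ?w = "\<lambda>k. if k < d then u k else v"
  have "(\<Sum>i<n. ?w k i * ?w l i) = (if k = l then 1 else 0)" if "k < Suc d" "l < Suc d" for k l
  proof -
    have orth': "(\<Sum>i<n. v i * u k i) = 0" if "k < d" for k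
      using orth[OF that] by (simp add: mult.commute)
    show ?thesis
      using that u[of k l] orth[of k] orth'[of l] vv
      by (cases "k < d"; cases "l < d") (simp_all add: less_Suc_eq)
  qed
  moreover have "D i j = (\<Sum>k<Suc d. ?w k i * ?w k j)" if "i < n" "j < n" for i j
    using E_u[OF that] by (simp add: E_def)
  ultimately show ?case by (intro exI[of _ ?w]) auto
qed

lemma orthogonal_projector_index:
  assumes D: "orthogonal_projector n D" and i: "i < n" "j < n"
  shows "D $$ (i, j) = D $$ (j, i)" and "(\<Sum>k<n. D $$ (i, k) * D $$ (k, j)) = D $$ (i, j)"
proof -
  have car: "D \<in> carrier_mat n n" and sym: "transpose_mat D = D" and idem: "D * D = D"
    using D by (auto simp: orthogonal_projector_def)
  have "transpose_mat D $$ (j, i) = D $$ (i, j)" using car i by simp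
  then show "D $$ (i, j) = D $$ (j, i)" unfolding sym by simp
  have "(D * D) $$ (i, j) = (\<Sum>k<n. D $$ (i, k) * D $$ (k, j))"
    using car i by (simp add: scalar_prod_def atLeast0LessThan)
  then show "(\<Sum>k<n. D $$ (i, k) * D $$ (k, j)) = D $$ (i, j)" unfolding idem by simp
qed

lemma orthogonal_projector_orthonormal_basis:
  assumes D: "orthogonal_projector n D" and tr: "mtrace D = real d"
  obtains u where "\<And>k l. k < d \<Longrightarrow> l < d \<Longrightarrow> (\<Sum>i<n. u k i * u l i) = (if k = l then 1 else 0)"
    and "\<And>i j. i < n \<Longrightarrow> j < n \<Longrightarrow> D $$ (i, j) = (\<Sum>k<d. u k i * u k j)"
proof -
  have "(\<Sum>i<n. D $$ (i, i)) = real d"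
    using D tr by (auto simp: mtrace_def orthogonal_projector_def)
  with orthogonal_projector_index[OF D]
  have "\<exists>u. (\<forall>k<d. \<forall>l<d. (\<Sum>i<n. u k i * u l i) = (if k = l then 1 else 0)) \<and>
             (\<forall>i<n. \<forall>j<n. D $$ (i, j) = (\<Sum>k<d. u k i * u k j))"
    by (intro projector_orthonormal_decomposition)
  then show thesis by (elim exE conjE) (rule that; simp)
qed

section \<open>Chi-square tails\<close>

lemma nn_integral_normal_density:
  assumes "\<sigma> > 0"
  shows "(\<integral>\<^sup>+x. ennreal (normal_density \<mu> \<sigma> x) \<partial>lborel) = 1"
  using assms by (subst nn_integral_eq_integral) auto

text \<open>Completing the square: the exponential factor shifts the mean of the density to \<open>a \<sigma>\<^sup>2\<close>.\<close>

lemma normal_exp_linear: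
  assumes "\<sigma> > 0"
  shows "(\<integral>\<^sup>+x. ennreal (normal_density 0 \<sigma> x) * ennreal (exp (a * x)) \<partial>lborel)
    = ennreal (exp (a\<^sup>2 * \<sigma>\<^sup>2 / 2))"
proof -
  have "normal_density 0 \<sigma> x * exp (a * x)
      = exp (a\<^sup>2 * \<sigma>\<^sup>2 / 2) * normal_density (a * \<sigma>\<^sup>2) \<sigma> x" for x
  proof -
    have "- x\<^sup>2 / (2 * \<sigma>\<^sup>2) + a * x = a\<^sup>2 * \<sigma>\<^sup>2 / 2 + - (x - a * \<sigma>\<^sup>2)\<^sup>2 / (2 * \<sigma>\<^sup>2)"
      using assms by (simp add: field_simps power2_eq_square)
    then show ?thesis by (simp add: normal_density_def exp_add[symmetric])
  qed
  then have "(\<integral>\<^sup>+x. ennreal (normal_density 0 \<sigma> x) * ennreal (exp (a * x)) \<partial>lborel)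
      = (\<integral>\<^sup>+x. ennreal (exp (a\<^sup>2 * \<sigma>\<^sup>2 / 2)) * ennreal (normal_density (a * \<sigma>\<^sup>2) \<sigma> x) \<partial>lborel)"
    by (simp add: ennreal_mult[symmetric])
  also have "\<dots> = ennreal (exp (a\<^sup>2 * \<sigma>\<^sup>2 / 2))"
    using assms by (subst nn_integral_cmult) (simp_all add: nn_integral_normal_density)
  finally show ?thesis .
qed

text \<open>The exponential factor only rescales the density, to the variance \<open>1 / (1 - 2 \<mu>)\<close>.\<close>

lemma std_normal_exp_square:
  assumes "\<mu> < 1 / 2"
  shows "(\<integral>\<^sup>+x. ennreal (std_normal_density x) * ennreal (exp (\<mu> * x\<^sup>2)) \<partial>lborel)
    = ennreal (1 / sqrt (1 - 2 * \<mu>))"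
proof -
  define \<tau> where "\<tau> = 1 / sqrt (1 - 2 * \<mu>)"
  have \<tau>: "\<tau> > 0" "\<tau>\<^sup>2 = 1 / (1 - 2 * \<mu>)"
    using assms by (simp_all add: \<tau>_def power_divide)
  have "std_normal_density x * exp (\<mu> * x\<^sup>2) = \<tau> * normal_density 0 \<tau> x" for x
  proof -
    have "- x\<^sup>2 / 2 + \<mu> * x\<^sup>2 = - x\<^sup>2 / (2 * \<tau>\<^sup>2)"
      using assms unfolding \<tau>(2) by (simp add: field_simps)
    then show ?thesis
      using \<tau>(1) by (simp add: normal_density_def exp_add[symmetric] real_sqrt_mult)
  qed
  then have "(\<integral>\<^sup>+x. ennreal (std_normal_density x) * ennreal (exp (\<mu> * x\<^sup>2)) \<partial>lborel)
      = (\<integral>\<^sup>+x. ennreal \<tau> * ennreal (normal_density 0 \<tau> x) \<partial>lborel)"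
    using \<tau>(1) by (simp add: ennreal_mult[symmetric])
  also have "\<dots> = ennreal \<tau>"
    using \<tau>(1) by (subst nn_integral_cmult) (simp_all add: nn_integral_normal_density)
  finally show ?thesis by (simp add: \<tau>_def)
qed

lemma sum_square_orthonormal:
  fixes u :: "nat \<Rightarrow> nat \<Rightarrow> real"
  assumes "\<And>k l. k < d \<Longrightarrow> l < d \<Longrightarrow> (\<Sum>i<n. u k i * u l i) = (if k = l then 1 else 0)"
  shows "(\<Sum>i<n. (\<Sum>k<d. c k * u k i)\<^sup>2) = (\<Sum>k<d. (c k)\<^sup>2)"
proof -
  have "(\<Sum>i<n. (\<Sum>k<d. c k * u k i)\<^sup>2) = (\<Sum>i<n. \<Sum>k<d. \<Sum>l<d. c k * c l * (u k i * u l i))"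
    by (simp add: power2_eq_square sum_product algebra_simps)
  also have "\<dots> = (\<Sum>k<d. \<Sum>i<n. \<Sum>l<d. c k * c l * (u k i * u l i))"
    by (rule sum.swap)
  also have "\<dots> = (\<Sum>k<d. \<Sum>l<d. \<Sum>i<n. c k * c l * (u k i * u l i))"
    by (rule sum.cong[OF refl], rule sum.swap)
  also have "\<dots> = (\<Sum>k<d. \<Sum>l<d. c k * c l * (if k = l then 1 else 0))"
    using assms by (simp add: sum_distrib_left[symmetric])
  also have "\<dots> = (\<Sum>k<d. (c k)\<^sup>2)"
    by (simp add: if_distrib power2_eq_square cong: if_cong)
  finally show ?thesis .
qed

context prob_space
begin

text \<open>The exponential moment of a chi-square variable, without the rotation invariance of the
  Gaussian law. Each square is linearised: \<open>exp (\<mu> y\<^sup>2 / \<sigma>\<^sup>2)\<close> is the mean of \<open>exp (s g y)\<close> over a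
  standard normal \<open>g\<close>, where \<open>s = sqrt (2 \<mu>) / \<sigma>\<close>. With one independent \<open>g\<^sub>k\<close> for each square,
  exchanging the two expectations leaves the exponential of a linear form in the independent errors,
  whose mean is \<open>exp (\<mu> |g|\<^sup>2)\<close> because the \<open>u\<^sub>k\<close> are orthonormal. The mean over \<open>g\<close> now factorises.\<close>

lemma gaussian_square_sum_mgf:
  fixes \<epsilon> :: "nat \<Rightarrow> 'a \<Rightarrow> real" and u :: "nat \<Rightarrow> nat \<Rightarrow> real"
  assumes \<sigma>: "\<sigma> > 0"
    and indep: "indep_vars (\<lambda>_. borel) \<epsilon> {..<n}"
    and normal: "\<And>i. i < n \<Longrightarrow> distributed M lborel (\<epsilon> i) (normal_density 0 \<sigma>)"
    and u: "\<And>k l. k < d \<Longrightarrow> l < d \<Longrightarrow> (\<Sum>i<n. u k i * u l i) = (if k = l then 1 else 0)"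
    and \<mu>: "0 \<le> \<mu>" "\<mu> < 1 / 2"
  shows "(\<integral>\<^sup>+\<omega>. ennreal (exp (\<mu> * (\<Sum>k<d. (\<Sum>i<n. u k i * \<epsilon> i \<omega>)\<^sup>2) / \<sigma>\<^sup>2)) \<partial>M)
    = ennreal ((1 / sqrt (1 - 2 * \<mu>)) ^ d)"
proof -
  define s where "s = sqrt (2 * \<mu>) / \<sigma>"
  have s2: "s\<^sup>2 * \<sigma>\<^sup>2 = 2 * \<mu>" "s\<^sup>2 / 2 = \<mu> / \<sigma>\<^sup>2"
    using \<sigma> \<mu> by (simp_all add: s_def power_divide)
  define X where "X k \<omega> = (\<Sum>i<n. u k i * \<epsilon> i \<omega>)" for k \<omega>
  define N :: "real measure" where "N = density lborel std_normal_density"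
  define G where "G = Pi\<^sub>M {..<d} (\<lambda>_. N)"
  have [measurable]: "\<epsilon> i \<in> borel_measurable M" if "i \<in> {..<n}" for i
    using indep that by (auto simp: indep_vars_def)
  have X_meas[measurable]: "X k \<in> borel_measurable M" for k
    unfolding X_def by measurable
  have [measurable_cong]: "sets N = sets borel" by (simp add: N_def)
  interpret N: prob_space N
    unfolding N_def by (rule prob_space_normal_density) simp
  interpret product_sigma_finite "\<lambda>_. N" by standard
  interpret G: prob_space G
    unfolding G_def by (rule prob_space_PiM) (rule N.prob_space_axioms)
  interpret pair_sigma_finite M G by standard
  have N_integral: "(\<integral>\<^sup>+x. f x \<partial>N) = (\<integral>\<^sup>+x. ennreal (std_normal_density x) * f x \<partial>lborel)"
    if "f \<in> borel_measurable borel" for f :: "real \<Rightarrow> ennreal"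
    unfolding N_def using that by (intro nn_integral_density) auto
  have linearize: "ennreal (exp (\<mu> * y\<^sup>2 / \<sigma>\<^sup>2)) = (\<integral>\<^sup>+g. ennreal (exp (s * g * y)) \<partial>N)" for y
  proof -
    have "(\<integral>\<^sup>+g. ennreal (exp (s * g * y)) \<partial>N) = (\<integral>\<^sup>+g. ennreal (exp ((s * y) * g)) \<partial>N)"
      by (simp add: mult_ac)
    also have "\<dots> = ennreal (exp ((s * y)\<^sup>2 / 2))"
      using normal_exp_linear[of 1 "s * y"] by (subst N_integral) auto
    also have "(s * y)\<^sup>2 / 2 = \<mu> * y\<^sup>2 / \<sigma>\<^sup>2"
      using s2(2) by (simp add: power_mult_distrib)
    finally show ?thesis ..
  qed
  \<comment> \<open>For a fixed auxiliary vector \<open>g\<close> the exponent is linear in the errors, and its variance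
    depends on \<open>|g|\<close> only.\<close>
  have inner: "(\<integral>\<^sup>+\<omega>. (\<Prod>k<d. ennreal (exp (s * g k * X k \<omega>))) \<partial>M) = (\<Prod>k<d. ennreal (exp (\<mu> * (g k)\<^sup>2)))"
    for g
  proof -
    define c where "c i = s * (\<Sum>k<d. g k * u k i)" for i
    have "(\<Prod>k<d. ennreal (exp (s * g k * X k \<omega>))) = (\<Prod>i<n. ennreal (exp (c i * \<epsilon> i \<omega>)))" for \<omega>
    proof -
      have "(\<Sum>k<d. s * g k * X k \<omega>) = (\<Sum>k<d. \<Sum>i<n. s * g k * u k i * \<epsilon> i \<omega>)"
        by (simp add: X_def sum_distrib_left mult_ac)
      also have "\<dots> = (\<Sum>i<n. c i * \<epsilon> i \<omega>)"
        unfolding c_def by (subst sum.swap) (simp add: sum_distrib_left sum_distrib_right mult_ac)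
      finally show ?thesis by (simp add: prod_ennreal exp_sum[symmetric])
    qed
    then have "(\<integral>\<^sup>+\<omega>. (\<Prod>k<d. ennreal (exp (s * g k * X k \<omega>))) \<partial>M)
        = (\<integral>\<^sup>+\<omega>. (\<Prod>i<n. ennreal (exp (c i * \<epsilon> i \<omega>))) \<partial>M)"
      by simp
    also have "\<dots> = (\<Prod>i<n. \<integral>\<^sup>+\<omega>. ennreal (exp (c i * \<epsilon> i \<omega>)) \<partial>M)"
    proof (rule indep_vars_nn_integral)
      show "indep_vars (\<lambda>_. borel) (\<lambda>i \<omega>. ennreal (exp (c i * \<epsilon> i \<omega>))) {..<n}"
        by (rule indep_vars_compose2[OF indep]) measurable
    qed auto
    also have "\<dots> = (\<Prod>i<n. ennreal (exp ((c i)\<^sup>2 * \<sigma>\<^sup>2 / 2)))"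
    proof (rule prod.cong[OF refl])
      fix i assume "i \<in> {..<n}"
      then show "(\<integral>\<^sup>+\<omega>. ennreal (exp (c i * \<epsilon> i \<omega>)) \<partial>M) = ennreal (exp ((c i)\<^sup>2 * \<sigma>\<^sup>2 / 2))"
        using distributed_nn_integral[OF normal[of i], of "\<lambda>x. ennreal (exp (c i * x))"]
          normal_exp_linear[OF \<sigma>, of "c i"] by simp
    qed
    also have "\<dots> = ennreal (exp (\<Sum>i<n. (c i)\<^sup>2 * \<sigma>\<^sup>2 / 2))"
      by (simp add: prod_ennreal exp_sum)
    also have "(\<Sum>i<n. (c i)\<^sup>2 * \<sigma>\<^sup>2 / 2) = s\<^sup>2 * \<sigma>\<^sup>2 / 2 * (\<Sum>i<n. (\<Sum>k<d. g k * u k i)\<^sup>2)"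
      unfolding c_def power_mult_distrib sum_distrib_left[symmetric] sum_distrib_right[symmetric]
        sum_divide_distrib[symmetric] by (simp add: mult_ac)
    also have "\<dots> = (\<Sum>k<d. \<mu> * (g k)\<^sup>2)"
      using s2(1) sum_square_orthonormal[OF u, of d g] by (simp add: sum_distrib_left[symmetric])
    finally show ?thesis by (simp add: prod_ennreal exp_sum)
  qed
  have "(\<integral>\<^sup>+\<omega>. ennreal (exp (\<mu> * (\<Sum>k<d. (X k \<omega>)\<^sup>2) / \<sigma>\<^sup>2)) \<partial>M)
      = (\<integral>\<^sup>+\<omega>. (\<Prod>k<d. \<integral>\<^sup>+g. ennreal (exp (s * g * X k \<omega>)) \<partial>N) \<partial>M)"
    unfolding linearize[symmetric]
    by (simp add: prod_ennreal exp_sum[symmetric] sum_distrib_left sum_divide_distrib)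
  also have "\<dots> = (\<integral>\<^sup>+\<omega>. (\<integral>\<^sup>+g. (\<Prod>k<d. ennreal (exp (s * g k * X k \<omega>))) \<partial>G) \<partial>M)"
    unfolding G_def by (intro nn_integral_cong product_nn_integral_prod[symmetric]) auto
  also have "\<dots> = (\<integral>\<^sup>+g. (\<integral>\<^sup>+\<omega>. (\<Prod>k<d. ennreal (exp (s * g k * X k \<omega>))) \<partial>M) \<partial>G)"
    unfolding G_def by (rule Fubini'[symmetric, unfolded G_def]) measurable
  also have "\<dots> = (\<Prod>k<d. \<integral>\<^sup>+g. ennreal (exp (\<mu> * g\<^sup>2)) \<partial>N)"
    unfolding inner G_def by (intro product_nn_integral_prod) auto
  also have "\<dots> = (\<Prod>k<d. ennreal (1 / sqrt (1 - 2 * \<mu>)))"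
    using std_normal_exp_square[OF \<mu>(2)] by (subst N_integral) auto
  also have "\<dots> = ennreal ((1 / sqrt (1 - 2 * \<mu>)) ^ d)"
    using \<mu> by (simp add: ennreal_power)
  finally show ?thesis by (simp add: X_def)
qed

text \<open>Chernoff bound with the parameter \<open>\<mu>\<close> that is optimal at the level \<open>d (1 + r)\<^sup>2\<close>, where
  \<open>r = sqrt (2 t / d)\<close>, that is \<open>sqrt d + sqrt (2 t) = sqrt d (1 + r)\<close>. It yields
  \<open>exp (- d r - t) (1 + r)\<^sup>d\<close>, and \<open>1 + r < exp r\<close> makes this strictly smaller than \<open>exp (- t)\<close>.\<close>

lemma gaussian_square_sum_tail:
  fixes \<epsilon> :: "nat \<Rightarrow> 'a \<Rightarrow> real" and u :: "nat \<Rightarrow> nat \<Rightarrow> real"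
  assumes \<sigma>: "\<sigma> > 0"
    and indep: "indep_vars (\<lambda>_. borel) \<epsilon> {..<n}"
    and normal: "\<And>i. i < n \<Longrightarrow> distributed M lborel (\<epsilon> i) (normal_density 0 \<sigma>)"
    and u: "\<And>k l. k < d \<Longrightarrow> l < d \<Longrightarrow> (\<Sum>i<n. u k i * u l i) = (if k = l then 1 else 0)"
    and d: "d > 0" and t: "t > 0"
  shows "prob {\<omega> \<in> space M. \<sigma> * (sqrt d + sqrt (2 * t)) < sqrt (\<Sum>k<d. (\<Sum>i<n. u k i * \<epsilon> i \<omega>)\<^sup>2)}
    < exp (- t)"
proof -
  define Q where "Q \<omega> = (\<Sum>k<d. (\<Sum>i<n. u k i * \<epsilon> i \<omega>)\<^sup>2)" for \<omega>
  define r where "r = sqrt (2 * t / d)"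
  define \<mu> where "\<mu> = (1 - 1 / (1 + r)\<^sup>2) / 2"
  define C where "C = exp (- (d * r + t))"
  have r: "r > 0" "d * r\<^sup>2 = 2 * t" "sqrt d * r = sqrt (2 * t)"
    using d t by (simp_all add: r_def real_sqrt_mult[symmetric])
  have \<mu>: "0 \<le> \<mu>" "\<mu> < 1 / 2" "1 / sqrt (1 - 2 * \<mu>) = 1 + r"
    using r(1) by (simp_all add: \<mu>_def real_sqrt_divide field_simps)
  have exponent: "\<mu> * (d * (1 + r)\<^sup>2) = d * r + t"
  proof -
    have "\<mu> * (d * (1 + r)\<^sup>2) = (d * (1 + r)\<^sup>2 - d) / 2"
      using r(1) by (simp add: \<mu>_def field_simps)
    also have "\<dots> = d * r + d * r\<^sup>2 / 2" by (simp add: power2_eq_square algebra_simps)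
    finally show ?thesis unfolding r(2) by simp
  qed
  have [measurable]: "\<epsilon> i \<in> borel_measurable M" if "i \<in> {..<n}" for i
    using indep that by (auto simp: indep_vars_def)
  have [measurable]: "Q \<in> borel_measurable M" unfolding Q_def by measurable
  have sub: "{\<omega> \<in> space M. \<sigma> * (sqrt d + sqrt (2 * t)) < sqrt (Q \<omega>)}
      \<subseteq> {\<omega> \<in> space M. 1 \<le> ennreal C * ennreal (exp (\<mu> * Q \<omega> / \<sigma>\<^sup>2))}"
  proof safe
    fix \<omega> assume less: "\<sigma> * (sqrt d + sqrt (2 * t)) < sqrt (Q \<omega>)"
    have "0 \<le> \<sigma> * (sqrt d + sqrt (2 * t))" using \<sigma> t by simp
    then have "(\<sigma> * (sqrt d + sqrt (2 * t)))\<^sup>2 \<le> Q \<omega>"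
      using less real_less_rsqrt[of "\<sigma> * (sqrt d + sqrt (2 * t))" "Q \<omega>"]
      by (smt (verit) power2_eq_square real_sqrt_less_iff real_sqrt_unique sqrt_le_D)
    moreover have "sqrt d + sqrt (2 * t) = sqrt d * (1 + r)"
      using r(3) by (simp add: algebra_simps)
    ultimately have "\<sigma>\<^sup>2 * (d * (1 + r)\<^sup>2) \<le> Q \<omega>"
      by (simp add: power_mult_distrib)
    then have "d * (1 + r)\<^sup>2 \<le> Q \<omega> / \<sigma>\<^sup>2"
      using \<sigma> by (simp add: field_simps)
    then have "d * r + t \<le> \<mu> * Q \<omega> / \<sigma>\<^sup>2"
      using mult_left_mono[OF _ \<mu>(1)] exponent by fastforce
    then have "1 \<le> C * exp (\<mu> * Q \<omega> / \<sigma>\<^sup>2)"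
      by (simp add: C_def exp_add[symmetric])
    then show "1 \<le> ennreal C * ennreal (exp (\<mu> * Q \<omega> / \<sigma>\<^sup>2))"
      by (simp add: ennreal_mult[symmetric] C_def)
  qed
  have "emeasure M {\<omega> \<in> space M. \<sigma> * (sqrt d + sqrt (2 * t)) < sqrt (Q \<omega>)}
      \<le> emeasure M {\<omega> \<in> space M. 1 \<le> ennreal C * ennreal (exp (\<mu> * Q \<omega> / \<sigma>\<^sup>2))}"
    by (rule emeasure_mono[OF sub]) measurable
  also have "\<dots> \<le> ennreal C * (\<integral>\<^sup>+\<omega>. ennreal (exp (\<mu> * Q \<omega> / \<sigma>\<^sup>2)) * indicator (space M) \<omega> \<partial>M)"
    using nn_integral_Markov_inequality[where u = "\<lambda>\<omega>. ennreal (exp (\<mu> * Q \<omega> / \<sigma>\<^sup>2))"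
        and A = "space M" and M = M and c = "ennreal C"]
    by simp
  also have "\<dots> = ennreal C * (\<integral>\<^sup>+\<omega>. ennreal (exp (\<mu> * Q \<omega> / \<sigma>\<^sup>2)) \<partial>M)"
    by (intro arg_cong2[where f = "(*)"] nn_integral_cong refl) simp
  also have "\<dots> = ennreal C * ennreal ((1 + r) ^ d)"
    unfolding Q_def
    using gaussian_square_sum_mgf[OF \<sigma> indep normal u \<mu>(1,2)] by (simp add: \<mu>(3))
  also have "\<dots> = ennreal (C * (1 + r) ^ d)"
    using r(1) by (simp add: ennreal_mult C_def)
  finally have "prob {\<omega> \<in> space M. \<sigma> * (sqrt d + sqrt (2 * t)) < sqrt (Q \<omega>)} \<le> C * (1 + r) ^ d"
    using r(1) by (simp add: emeasure_eq_measure C_def)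
  also have "\<dots> < C * exp r ^ d"
  proof (intro mult_strict_left_mono power_strict_mono)
    have "1 + r < (1 + r / 2)\<^sup>2" using r(1) by (simp add: power2_eq_square algebra_simps)
    also have "\<dots> \<le> exp (r / 2) ^ 2" using r(1) by (intro power_mono) auto
    finally show "1 + r < exp r" by (simp add: exp_of_nat_mult[symmetric])
  qed (use r(1) d in \<open>auto simp: C_def\<close>)
  also have "\<dots> = exp (- t)"
    by (simp add: C_def exp_of_nat_mult[symmetric] exp_add[symmetric])
  finally show ?thesis by (simp add: Q_def)
qed

end

section \<open>Norms of projected vectors\<close>

context
  fixes D :: "real Matrix.mat" and n d :: nat and u :: "nat \<Rightarrow> nat \<Rightarrow> real"
  assumes D: "D \<in> carrier_mat n n"
    and u: "\<And>k l. k < d \<Longrightarrow> l < d \<Longrightarrow> (\<Sum>i<n. u k i * u l i) = (if k = l then 1 else 0)"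
    and D_u: "\<And>i j. i < n \<Longrightarrow> j < n \<Longrightarrow> D $$ (i, j) = (\<Sum>k<d. u k i * u k j)"
begin

private lemma projector_apply:
  assumes "i < n"
  shows "vec_index (D *\<^sub>v Matrix.vec n e) i = (\<Sum>k<d. (\<Sum>j<n. u k j * e j) * u k i)"
proof -
  have "vec_index (D *\<^sub>v Matrix.vec n e) i = (\<Sum>j<n. \<Sum>k<d. u k i * u k j * e j)"
    using assms D by (simp add: scalar_prod_def atLeast0LessThan D_u sum_distrib_right)
  also have "\<dots> = (\<Sum>k<d. (\<Sum>j<n. u k j * e j) * u k i)"
    by (subst sum.swap) (simp add: sum_distrib_left mult_ac)
  finally show ?thesis .
qed

lemma vnorm_projector:
  "vnorm (D *\<^sub>v Matrix.vec n e) = sqrt (\<Sum>k<d. (\<Sum>i<n. u k i * e i)\<^sup>2)"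
proof -
  have "scalar_prod (D *\<^sub>v Matrix.vec n e) (D *\<^sub>v Matrix.vec n e)
      = (\<Sum>i<n. (\<Sum>k<d. (\<Sum>j<n. u k j * e j) * u k i)\<^sup>2)"
    using D by (auto simp: scalar_prod_def[of _ "D *\<^sub>v _"] atLeast0LessThan projector_apply
        power2_eq_square simp del: index_mult_mat_vec intro!: sum.cong)
  then show ?thesis
    by (simp add: vnorm_def sum_square_orthonormal[OF u])
qed

text \<open>With \<open>w = D v\<close> one has \<open>\<langle>w, v\<rangle> = |w|\<^sup>2\<close>, so \<open>0 \<le> |v - w|\<^sup>2 = |v|\<^sup>2 - |w|\<^sup>2\<close>.\<close>

lemma vnorm_projector_le:
  assumes "v \<in> carrier_vec n"
  shows "vnorm (D *\<^sub>v v) \<le> vnorm v"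
proof -
  define e where "e i = vec_index v i" for i
  have v: "v = Matrix.vec n e" using assms by (intro eq_vecI) (auto simp: e_def)
  define w where "w i = (\<Sum>k<d. (\<Sum>j<n. u k j * e j) * u k i)" for i
  have ww: "(\<Sum>i<n. (w i)\<^sup>2) = (\<Sum>k<d. (\<Sum>j<n. u k j * e j)\<^sup>2)"
    unfolding w_def by (rule sum_square_orthonormal[OF u])
  have "(\<Sum>i<n. w i * e i) = (\<Sum>k<d. \<Sum>i<n. (\<Sum>j<n. u k j * e j) * (u k i * e i))"
    unfolding w_def by (subst sum.swap) (simp add: sum_distrib_right mult.assoc)
  also have "\<dots> = (\<Sum>i<n. (w i)\<^sup>2)"
    unfolding ww by (simp add: sum_distrib_left[symmetric] power2_eq_square)
  finally have we: "(\<Sum>i<n. w i * e i) = (\<Sum>i<n. (w i)\<^sup>2)" .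
  have "0 \<le> (\<Sum>i<n. (e i - w i)\<^sup>2)" by (simp add: sum_nonneg)
  also have "\<dots> = (\<Sum>i<n. (e i)\<^sup>2) - 2 * (\<Sum>i<n. w i * e i) + (\<Sum>i<n. (w i)\<^sup>2)"
    by (simp add: power2_diff sum.distrib sum_subtractf sum_distrib_left mult_ac)
  also have "\<dots> = (\<Sum>i<n. (e i)\<^sup>2) - (\<Sum>i<n. (w i)\<^sup>2)" by (simp add: we)
  finally show ?thesis
    unfolding v vnorm_projector ww[symmetric]
    by (simp add: vnorm_def scalar_prod_def atLeast0LessThan power2_eq_square)
qed

text \<open>The supremum is attained at a basis vector of the range, which exists as \<open>d > 0\<close>.\<close>

lemma op_norm_scaled_projector:
  assumes "d > 0" "c \<ge> 0"
  shows "op_norm (c \<cdot>\<^sub>m D) = c"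
  unfolding op_norm_def
proof (rule cSup_eq_maximum)
  have scale: "vnorm ((c \<cdot>\<^sub>m D) *\<^sub>v v) = c * vnorm (D *\<^sub>v v)" if "v \<in> carrier_vec n" for v
  proof -
    have "(c \<cdot>\<^sub>m D) *\<^sub>v v = c \<cdot>\<^sub>v (D *\<^sub>v v)"
      using D that by (intro eq_vecI) (auto simp: scalar_prod_def sum_distrib_left mult_ac)
    then show ?thesis
      using assms(2) D by (simp add: vnorm_def real_sqrt_mult)
  qed
  let ?v = "Matrix.vec n (u 0)"
  have "(\<Sum>k<d. (\<Sum>i<n. u k i * u 0 i)\<^sup>2) = (\<Sum>k<d. if k = 0 then 1 else 0)"
    using assms(1) by (intro sum.cong) (auto simp: u)
  then have "vnorm (D *\<^sub>v ?v) = 1"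
    using assms(1) by (simp add: vnorm_projector)
  moreover have "vnorm ?v = 1"
    using u[of 0 0] assms(1) by (simp add: vnorm_def scalar_prod_def atLeast0LessThan)
  ultimately show "c \<in> {vnorm ((c \<cdot>\<^sub>m D) *\<^sub>v v) | v. v \<in> carrier_vec (dim_col (c \<cdot>\<^sub>m D)) \<and> vnorm v \<le> 1}"
    using D by (auto simp: scale intro!: exI[of _ ?v])
  fix y assume "y \<in> {vnorm ((c \<cdot>\<^sub>m D) *\<^sub>v v) | v. v \<in> carrier_vec (dim_col (c \<cdot>\<^sub>m D)) \<and> vnorm v \<le> 1}"
  then obtain v where v: "v \<in> carrier_vec n" "vnorm v \<le> 1" "y = c * vnorm (D *\<^sub>v v)"
    using D by (auto simp: scale)
  then have "vnorm (D *\<^sub>v v) \<le> 1" using vnorm_projector_le by fastforce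
  then show "y \<le> c" using v(3) assms(2) by (simp add: mult_left_le)
qed

end

section \<open>Covariance of the noise and multiplicity correction\<close>

context prob_space
begin

lemma cov_mat_linear_image:
  fixes \<epsilon> :: "nat \<Rightarrow> 'a \<Rightarrow> real"
  assumes A: "A \<in> carrier_mat n n" and \<sigma>: "\<sigma> > 0"
    and indep: "indep_vars (\<lambda>_. borel) \<epsilon> {..<n}"
    and normal: "\<And>i. i < n \<Longrightarrow> distributed M lborel (\<epsilon> i) (normal_density 0 \<sigma>)"
  shows "cov_mat M n (\<lambda>\<omega>. A *\<^sub>v Matrix.vec n (\<lambda>i. \<epsilon> i \<omega>)) = \<sigma>\<^sup>2 \<cdot>\<^sub>m (A * transpose_mat A)"
proof -
  have int: "integrable M (\<epsilon> k)" if "k < n" for k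
    using integrable_normal_moment_nz_1[OF \<sigma>, of 0]
    by (intro distributed_integrable_var[OF normal[OF that]]) auto
  have mean: "(\<integral>\<omega>. \<epsilon> k \<omega> \<partial>M) = 0" if "k < n" for k
    by (rule normal_distributed_expectation[OF \<sigma> normal[OF that]])
  have pair: "integrable M (\<lambda>\<omega>. \<epsilon> k \<omega> * \<epsilon> l \<omega>)
      \<and> (\<integral>\<omega>. \<epsilon> k \<omega> * \<epsilon> l \<omega> \<partial>M) = (if k = l then \<sigma>\<^sup>2 else 0)" if kl: "k < n" "l < n" for k l
  proof (cases "k = l")
    case True
    have "integrable M (\<lambda>\<omega>. (\<epsilon> k \<omega>)\<^sup>2)"
      using integrable_normal_moment[OF \<sigma>, of 0 2]
        distributed_integrable[OF normal[OF kl(1)], of "\<lambda>x. x\<^sup>2"] by simp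
    moreover have "(\<integral>\<omega>. (\<epsilon> k \<omega>)\<^sup>2 \<partial>M) = \<sigma>\<^sup>2"
      using normal_distributed_variance[OF \<sigma> normal[OF kl(1)]] by (simp add: mean[OF kl(1)])
    ultimately show ?thesis by (simp add: True power2_eq_square)
  next
    case False
    have sub: "indep_vars (\<lambda>_. borel) \<epsilon> {k, l}"
      using kl by (intro indep_vars_subset[OF indep]) auto
    have each: "integrable M (\<epsilon> i)" if "i \<in> {k, l}" for i
      using that kl int by auto
    have fin: "finite {k, l}" by simp
    show ?thesis
      using indep_vars_lebesgue_integral[OF fin sub each] indep_vars_integrable[OF fin sub each]
        False kl by (simp add: mean)
  qed
  let ?X = "\<lambda>i \<omega>. \<Sum>k<n. A $$ (i, k) * \<epsilon> k \<omega>"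
  have X: "vec_index (A *\<^sub>v Matrix.vec n (\<lambda>i. \<epsilon> i \<omega>)) i = ?X i \<omega>" if "i < n" for i \<omega>
    using A that by (simp add: scalar_prod_def atLeast0LessThan)
  have mean_X: "(\<integral>\<omega>. ?X i \<omega> \<partial>M) = 0" for i
    by (subst Bochner_Integration.integral_sum) (auto simp: int mean)
  have cov_X: "(\<integral>\<omega>. ?X i \<omega> * ?X j \<omega> \<partial>M) = \<sigma>\<^sup>2 * (\<Sum>k<n. A $$ (i, k) * A $$ (j, k))" for i j
  proof -
    have "(\<integral>\<omega>. ?X i \<omega> * ?X j \<omega> \<partial>M)
        = (\<integral>\<omega>. (\<Sum>k<n. \<Sum>l<n. (A $$ (i, k) * A $$ (j, l)) * (\<epsilon> k \<omega> * \<epsilon> l \<omega>)) \<partial>M)"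
      by (simp add: sum_product mult_ac)
    also have "\<dots> = (\<Sum>k<n. \<Sum>l<n. (A $$ (i, k) * A $$ (j, l)) * (\<integral>\<omega>. \<epsilon> k \<omega> * \<epsilon> l \<omega> \<partial>M))"
      using pair by (subst Bochner_Integration.integral_sum, force,
          intro sum.cong refl, subst Bochner_Integration.integral_sum) auto
    also have "\<dots> = (\<Sum>k<n. \<Sum>l<n. (A $$ (i, k) * A $$ (j, l)) * (if k = l then \<sigma>\<^sup>2 else 0))"
      using pair by (intro sum.cong refl) auto
    also have "\<dots> = \<sigma>\<^sup>2 * (\<Sum>k<n. A $$ (i, k) * A $$ (j, k))"
      by (simp add: if_distrib sum_distrib_left mult_ac cong: if_cong)
    finally show ?thesis .
  qed
  show ?thesis
  proof (rule eq_matI)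
    fix i j assume "i < dim_row (\<sigma>\<^sup>2 \<cdot>\<^sub>m (A * transpose_mat A))" "j < dim_col (\<sigma>\<^sup>2 \<cdot>\<^sub>m (A * transpose_mat A))"
    then have ij: "i < n" "j < n" using A by auto
    show "cov_mat M n (\<lambda>\<omega>. A *\<^sub>v Matrix.vec n (\<lambda>i. \<epsilon> i \<omega>)) $$ (i, j) = (\<sigma>\<^sup>2 \<cdot>\<^sub>m (A * transpose_mat A)) $$ (i, j)"
      unfolding cov_mat_def index_mat(1)[OF ij] prod.case X[OF ij(1)] X[OF ij(2)] mean_X
      using ij A by (simp add: cov_X scalar_prod_def atLeast0LessThan)
  qed (use A in \<open>auto simp: cov_mat_def\<close>)
qed

text \<open>The lower bound is monotonicity of probability. For the upper bound, suppose that \<open>t\<close> exceeds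
  \<open>x + log |A|\<close> and pick \<open>s\<close> strictly in between. The tail function is strictly increasing, so
  \<open>X \<ge> z t\<close> implies \<open>X > z s\<close>, and the union bound over these larger events gives
  \<open>exp (- x) \<le> |A| exp (- s) < exp (- x)\<close>. That the tail function attains
  every level \<open>exp (- s)\<close> thus takes the place of continuity of the laws of the \<open>X m\<close>.\<close>

lemma multiplicity_correction_bounds:
  fixes X :: "'b \<Rightarrow> 'a \<Rightarrow> real" and z :: "'b \<Rightarrow> real \<Rightarrow> real"
  assumes A: "finite A" "A \<noteq> {}"
    and [measurable]: "\<And>m. m \<in> A \<Longrightarrow> X m \<in> borel_measurable M"
    and tail: "\<And>m s. m \<in> A \<Longrightarrow> s \<ge> 0 \<Longrightarrow> prob {\<omega> \<in> space M. X m \<omega> > z m s} = exp (- s)"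
    and joint: "prob (\<Union>m\<in>A. {\<omega> \<in> space M. X m \<omega> \<ge> z m t}) = exp (- x)"
    and x: "x > 0" and t: "t \<ge> 0"
  shows "x \<le> t" and "t \<le> x + ln (real (card A))"
proof -
  have events: "{\<omega> \<in> space M. X m \<omega> > c} \<in> events" "{\<omega> \<in> space M. X m \<omega> \<ge> c} \<in> events" if "m \<in> A" for m c
    using that by measurable
  have union_event: "(\<Union>m\<in>A. {\<omega> \<in> space M. X m \<omega> \<ge> z m t}) \<in> events"
    using A events by (intro sets.finite_UN) auto
  obtain m where m: "m \<in> A" using A by auto
  have "prob {\<omega> \<in> space M. X m \<omega> > z m t} \<le> prob (\<Union>m\<in>A. {\<omega> \<in> space M. X m \<omega> \<ge> z m t})"
    using m by (intro finite_measure_mono[OF _ union_event]) (auto intro: less_imp_le)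
  then show "x \<le> t" using tail[OF m t] joint by simp
  show "t \<le> x + ln (real (card A))"
  proof (rule ccontr)
    let ?y = "x + ln (real (card A))"
    assume "\<not> t \<le> ?y"
    then obtain s where s: "?y < s" "s < t" using dense[of ?y t] by auto
    have card: "real (card A) \<ge> 1" using A by (simp add: card_gt_0_iff Suc_le_eq)
    then have "s \<ge> 0" using s(1) x ln_ge_zero[OF card] by linarith
    have z_less: "z m s < z m t" if "m \<in> A" for m
    proof (rule ccontr)
      assume "\<not> z m s < z m t"
      then have "prob {\<omega> \<in> space M. X m \<omega> > z m s} \<le> prob {\<omega> \<in> space M. X m \<omega> > z m t}"
        using events that by (intro finite_measure_mono) auto
      then show False using tail[OF that] t \<open>s \<ge> 0\<close> s(2) by simp
    qed
    have "exp (- x) \<le> prob (\<Union>m\<in>A. {\<omega> \<in> space M. X m \<omega> > z m s})"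
      unfolding joint[symmetric]
    proof (intro finite_measure_mono)
      show "(\<Union>m\<in>A. {\<omega> \<in> space M. X m \<omega> > z m s}) \<in> events"
        using A events by (intro sets.finite_UN) auto
    qed (use z_less in \<open>fastforce intro: less_le_trans\<close>)
    also have "\<dots> \<le> (\<Sum>m\<in>A. prob {\<omega> \<in> space M. X m \<omega> > z m s})"
      using A events by (intro finite_measure_subadditive_finite) auto
    also have "\<dots> = real (card A) * exp (- s)"
      using tail \<open>s \<ge> 0\<close> by simp
    also have "\<dots> < real (card A) * exp (- ?y)"
      using s card by (intro mult_strict_left_mono) auto
    also have "\<dots> = exp (- x)"
      using card by (simp add: exp_diff exp_minus field_simps exp_add)
    finally show False by simp
  qed
qed

end

section \<open>Critical values in projection estimation\<close>

context prob_space
begin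

lemma projection_noise:
  fixes \<epsilon> :: "nat \<Rightarrow> 'a \<Rightarrow> real"
  assumes \<sigma>: "\<sigma> > 0"
    and indep: "indep_vars (\<lambda>_. borel) \<epsilon> {..<n}"
    and normal: "\<And>i. i < n \<Longrightarrow> distributed M lborel (\<epsilon> i) (normal_density 0 \<sigma>)"
    and \<Psi>: "\<Psi> \<in> carrier_mat p n" and m: "m0 < m" "m \<le> p"
    and inv: "invertible_mat (gram \<Psi> m)" "invertible_mat (gram \<Psi> m0)"
  shows "pdim M \<Psi> \<epsilon> m m0 = \<sigma>\<^sup>2 * (real m - real m0)"
    and "lam M \<Psi> \<epsilon> m m0 = \<sigma>\<^sup>2"
    and "(\<lambda>\<omega>. vnorm (xi \<Psi> \<epsilon> m m0 \<omega>)) \<in> borel_measurable M"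
    and "\<And>t. t > 0 \<Longrightarrow> prob {\<omega> \<in> space M.
      \<sigma> * (sqrt (real m - real m0) + sqrt (2 * t)) < vnorm (xi \<Psi> \<epsilon> m m0 \<omega>)} < exp (- t)"
proof -
  define D where "D = proj \<Psi> m - proj \<Psi> m0"
  have le: "m0 \<le> m" and pos: "m - m0 > 0" and d: "real (m - m0) = real m - real m0"
    using m by auto
  have proj: "orthogonal_projector n D" and tr: "mtrace D = real (m - m0)"
    unfolding D_def using orthogonal_projector_proj_diff[OF \<Psi> le m(2) inv] by auto
  have car: "D \<in> carrier_mat n n" and DD: "D * transpose_mat D = D"
    using proj by (auto simp: orthogonal_projector_def)
  obtain u where u: "\<And>k l. k < m - m0 \<Longrightarrow> l < m - m0 \<Longrightarrow> (\<Sum>i<n. u k i * u l i) = (if k = l then 1 else 0)"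
    and D_u: "\<And>i j. i < n \<Longrightarrow> j < n \<Longrightarrow> D $$ (i, j) = (\<Sum>k<m - m0. u k i * u k j)"
    using orthogonal_projector_orthonormal_basis[OF proj tr] by blast
  have xi: "xi \<Psi> \<epsilon> m m0 = (\<lambda>\<omega>. D *\<^sub>v Matrix.vec n (\<lambda>i. \<epsilon> i \<omega>))"
    using \<Psi> by (auto simp: xi_def D_def)
  have V: "Vmat M \<Psi> \<epsilon> m m0 = \<sigma>\<^sup>2 \<cdot>\<^sub>m D"
    unfolding Vmat_def xi using cov_mat_linear_image[OF car \<sigma> indep normal] \<Psi> DD by auto
  show "pdim M \<Psi> \<epsilon> m m0 = \<sigma>\<^sup>2 * (real m - real m0)"
    using tr car unfolding d by (auto simp: pdim_def V mtrace_def sum_distrib_left[symmetric])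
  show "lam M \<Psi> \<epsilon> m m0 = \<sigma>\<^sup>2"
    unfolding lam_def V by (rule op_norm_scaled_projector[OF car u D_u pos]) auto
  have norm: "vnorm (xi \<Psi> \<epsilon> m m0 \<omega>) = sqrt (\<Sum>k<m - m0. (\<Sum>i<n. u k i * \<epsilon> i \<omega>)\<^sup>2)" for \<omega>
    unfolding xi by (rule vnorm_projector[OF car u D_u])
  have [measurable]: "\<epsilon> i \<in> borel_measurable M" if "i \<in> {..<n}" for i
    using indep that by (auto simp: indep_vars_def)
  show "(\<lambda>\<omega>. vnorm (xi \<Psi> \<epsilon> m m0 \<omega>)) \<in> borel_measurable M"
    unfolding norm by measurable
  show "prob {\<omega> \<in> space M.
      \<sigma> * (sqrt (real m - real m0) + sqrt (2 * t)) < vnorm (xi \<Psi> \<epsilon> m m0 \<omega>)} < exp (- t)" if "t > 0" for t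
    unfolding norm d[symmetric] by (rule gaussian_square_sum_tail[OF \<sigma> indep normal u pos that])
qed

end

text \<open>The largest model satisfies the oracle condition vacuously, so the minimum is over a nonempty
  set.\<close>

lemma oracle_model_mem:
  assumes "finite M" "M \<noteq> {}"
  shows "oracle_model P \<Psi> \<epsilon> f \<beta> M \<in> M"
proof -
  have "above M (Max M) = {}" using assms by (auto simp: above_def not_less)
  then have "Max M \<in> M \<and> (\<forall>m\<in>above M (Max M). (vnorm (bias \<Psi> f m (Max M)))\<^sup>2 \<le> \<beta>\<^sup>2 * pdim P \<Psi> \<epsilon> m (Max M))"
    using assms by simp
  then show ?thesis unfolding oracle_model_def by (rule LeastI2) simp
qed

theorem corollary2p5:
  fixes P :: "'a measure"
    and \<epsilon> :: "nat \<Rightarrow> 'a \<Rightarrow> real"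
    and \<Psi> :: "real Matrix.mat"
    and \<theta> fstar :: "real Matrix.vec"
    and n p :: nat
    and M Mc :: "nat set"
    and \<sigma> \<beta> x :: real
    and z :: "nat \<Rightarrow> nat \<Rightarrow> real \<Rightarrow> real"
    and q :: "nat \<Rightarrow> real"
    and zc :: "nat \<Rightarrow> nat \<Rightarrow> real"
    and mstar :: nat
  assumes "prob_space P"
    and "\<Psi> \<in> carrier_mat p n"
    and "\<theta> \<in> carrier_vec p"
    and "fstar = transpose_mat \<Psi> *\<^sub>v \<theta>"
    and "finite M" and "M \<noteq> {}"
    and "\<forall>m\<in>M. 1 \<le> m \<and> m \<le> p \<and> invertible_mat (gram \<Psi> m)"
    and "\<sigma> > 0"
    and "prob_space.indep_vars P (\<lambda>_. borel) \<epsilon> {..<n}"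
    and "\<forall>i<n. distributed P lborel (\<epsilon> i) (normal_density 0 \<sigma>)"
    and "x > 0" and "\<beta> \<ge> 0"
    and "is_tail_function P \<Psi> \<epsilon> M z"
    and "is_mult_correction P \<Psi> \<epsilon> M z x q"
    and "zc = crit P \<Psi> \<epsilon> z q x \<beta>"
    and "mstar = oracle_model P \<Psi> \<epsilon> fstar \<beta> M"
    and "is_Mc \<Psi> fstar z zc x M mstar Mc"
  shows "(\<forall>m0\<in>M. \<forall>m\<in>M. m0 < m \<longrightarrow>
            pdim P \<Psi> \<epsilon> m m0 = \<sigma>\<^sup>2 * (real m - real m0) \<and>
            lam P \<Psi> \<epsilon> m m0 = \<sigma>\<^sup>2 \<and>
            zc m m0 \<le> \<sigma> * (1 + \<beta>) * sqrt (real m - real m0)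
                       + \<sigma> * sqrt (2 * x + 2 * ln (real (card M)))) \<and>
         zbar zc M mstar Mc \<le> \<sigma> * (1 + \<beta>) * sqrt (real mstar)
                       + \<sigma> * sqrt (2 * x + 2 * ln (real (card M)))"
proof -
  interpret prob_space P by (rule assms(1))
  have normal: "\<And>i. i < n \<Longrightarrow> distributed P lborel (\<epsilon> i) (normal_density 0 \<sigma>)"
    using assms(10) by blast
  have cardM: "real (card M) \<ge> 1"
    using assms(5,6) by (simp add: card_gt_0_iff Suc_le_eq)
  have main: "pdim P \<Psi> \<epsilon> m m0 = \<sigma>\<^sup>2 * (real m - real m0) \<and> lam P \<Psi> \<epsilon> m m0 = \<sigma>\<^sup>2 \<and>
      zc m m0 \<le> \<sigma> * (1 + \<beta>) * sqrt (real m - real m0) + \<sigma> * sqrt (2 * x + 2 * ln (real (card M)))"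
    if m0: "m0 \<in> M" and m: "m \<in> M" and less: "m0 < m" for m m0
  proof -
    have noise: "pdim P \<Psi> \<epsilon> k m0 = \<sigma>\<^sup>2 * (real k - real m0)" "lam P \<Psi> \<epsilon> k m0 = \<sigma>\<^sup>2"
      "(\<lambda>\<omega>. vnorm (xi \<Psi> \<epsilon> k m0 \<omega>)) \<in> borel_measurable P"
      "\<And>t. t > 0 \<Longrightarrow> prob {\<omega> \<in> space P.
        \<sigma> * (sqrt (real k - real m0) + sqrt (2 * t)) < vnorm (xi \<Psi> \<epsilon> k m0 \<omega>)} < exp (- t)"
      if "k \<in> above M m0" for k
      using that m0 assms(7) by (auto simp: above_def
          intro!: projection_noise[OF assms(8,9) normal assms(2)])
    define t where "t = x + q m0"
    have mA: "m \<in> above M m0" using m less by (simp add: above_def)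
    have A: "finite (above M m0)" "above M m0 \<noteq> {}" using mA assms(5) by (auto simp: above_def)
    have tail: "prob {\<omega> \<in> space P. vnorm (xi \<Psi> \<epsilon> k m0 \<omega>) > z k m0 s} = exp (- s)"
      if "k \<in> above M m0" "s \<ge> 0" for k s
      using assms(13) m0 that by (simp add: is_tail_function_def)
    have joint: "prob (\<Union>k\<in>above M m0. {\<omega> \<in> space P. vnorm (xi \<Psi> \<epsilon> k m0 \<omega>) \<ge> z k m0 t}) = exp (- x)"
      and t0: "t \<ge> 0"
      using assms(14) m0 A(2) by (simp_all add: is_mult_correction_def t_def)
    note bounds = multiplicity_correction_bounds[OF A noise(3) tail joint assms(11) t0]
    have t: "t > 0" using bounds(1) assms(11) by simp
    have "card (above M m0) \<le> card M"
      using assms(5) by (intro card_mono) (auto simp: above_def)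
    moreover have "card (above M m0) > 0" using A by (simp add: card_gt_0_iff)
    ultimately have t_le: "t \<le> x + ln (real (card M))"
      using bounds(2) by (smt (verit) ln_mono of_nat_0_less_iff of_nat_mono)
    let ?b = "\<sigma> * (sqrt (real m - real m0) + sqrt (2 * t))"
    \<comment> \<open>Otherwise \<open>z m m0 t\<close> would be exceeded with probability less than \<open>exp (- t)\<close>.\<close>
    have "z m m0 t \<le> ?b"
    proof (rule ccontr)
      assume "\<not> z m m0 t \<le> ?b"
      then have "{\<omega> \<in> space P. vnorm (xi \<Psi> \<epsilon> m m0 \<omega>) > z m m0 t}
          \<subseteq> {\<omega> \<in> space P. ?b < vnorm (xi \<Psi> \<epsilon> m m0 \<omega>)}" by auto
      then have "prob {\<omega> \<in> space P. vnorm (xi \<Psi> \<epsilon> m m0 \<omega>) > z m m0 t}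
          \<le> prob {\<omega> \<in> space P. ?b < vnorm (xi \<Psi> \<epsilon> m m0 \<omega>)}"
        using noise(3)[OF mA] by (intro finite_measure_mono) measurable
      then show False using tail[OF mA t0] noise(4)[OF mA t] by simp
    qed
    moreover have "sqrt (2 * t) \<le> sqrt (2 * x + 2 * ln (real (card M)))"
      using t_le by simp
    then have "?b \<le> \<sigma> * (sqrt (real m - real m0) + sqrt (2 * x + 2 * ln (real (card M))))"
      using assms(8) by simp
    moreover have "sqrt (pdim P \<Psi> \<epsilon> m m0) = \<sigma> * sqrt (real m - real m0)"
      using assms(8) noise(1)[OF mA] by (simp add: real_sqrt_mult)
    then have "zc m m0 = z m m0 t + \<beta> * (\<sigma> * sqrt (real m - real m0))"
      by (simp add: assms(15) crit_def t_def)
    ultimately show ?thesis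
      using noise(1,2)[OF mA] by (simp add: algebra_simps)
  qed
  have mstar: "mstar \<in> M"
    unfolding assms(16) by (rule oracle_model_mem[OF assms(5,6)])
  have "zbar zc M mstar Mc \<le> \<sigma> * (1 + \<beta>) * sqrt (real mstar) + \<sigma> * sqrt (2 * x + 2 * ln (real (card M)))"
    (is "_ \<le> ?B")
  proof (cases "below M mstar - Mc = {}")
    case True
    have "0 \<le> 2 * x + 2 * ln (real (card M))"
      using assms(11) ln_ge_zero[OF cardM] by simp
    then show ?thesis using True assms(8,12) by (simp add: zbar_def)
  next
    case False
    have "zc mstar m \<le> ?B" if "m \<in> below M mstar - Mc" for m
    proof -
      have m: "m \<in> M" "m < mstar" using that by (auto simp: below_def)
      have "\<sigma> * (1 + \<beta>) * sqrt (real mstar - real m) \<le> \<sigma> * (1 + \<beta>) * sqrt (real mstar)"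
        using assms(8,12) by (intro mult_left_mono) auto
      then show ?thesis using main[OF m(1) mstar m(2)] by linarith
    qed
    moreover have "finite (below M mstar - Mc)" using assms(5) by (simp add: below_def)
    ultimately show ?thesis using False by (simp add: zbar_def)
  qed
  then show ?thesis using main by blast
qed

end
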